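(* Let $\mathcal{P}=(\mathscr{P}_n(x))_{n\ge 0}$ be a sequence of real polynomials with nonnegative coefficients, $\deg(\mathscr{P}_n(x))=n$, satisfying $$\mathscr{P}_{n+1}(x)=p_n(x)\mathscr{P}_n(x)+q(x)\,\frac{d}{dx}\mathscr{P}_n(x)\qquad (n\ge 0)$$ with real polynomials $p_n(x)$, $q(x)$, and assume $\mathscr{P}_n(x)\ll\mathscr{P}_{n+1}(x)$ for all $n$. For $n\ge 1$ let $r_1,\dots,r_n$ be all the zeros of $\mathscr{P}_n(x)$, and suppose that there are a real polynomial $h_n(x)$ and real numbers $a_{k_i}$ (depending on $n$, $1\le k\le n$, $0\le i\le 3$) such that $$(x-r_k)\bigl[p_n(x)-p_{n-1}(x)\bigr]+q(x)=h_n(x)\sum_{i=0}^{3}a_{k_i}(x-r_k)^i\qquad(1\le k\le n).$$ Assume that $h_n(x)$ is Hurwitz stable for each $n$. If, for each $n$, all elements of $\bigcup_{k=1}^n\{-a_{k_3},a_{k_1},a_{k_0}\}$ have the same sign (all $\ge 0$ or all $\le 0$), and the values $h_n(x)\sum_{i=0}^{3}a_{k_i}(x-r_k)^i$ have the same sign for all $1\le k\le n$ and all $x>0$, then $$\mathfrak{I}_n(\mathcal{P};x):=(\mathscr{P}_{n+1}(x))^2-\mathscr{P}_{n+2}(x)\mathscr{P}_n(x)$$ is Hurwitz stable for each $n$.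
   Context: A polynomial $f\in\mathbb{C}[x]$ is Hurwitz stable if it is identically zero or $f(x)\ne0$ whenever $\Re(x)>0$. For real-rooted real polynomials $f,g$ with zeros $\{r_i\}$, $\{s_j\}$ listed in decreasing order, write $g\preceq f$ if either $\deg f=\deg g+1=n$ and $r_n\le s_{n-1}\le\cdots\le s_2\le r_2\le s_1\le r_1$, or $\deg f=\deg g=n$ and $s_n\le r_n\le\cdots\le s_2\le r_2\le s_1\le r_1$. Write $g\ll f$ if $g\preceq f$ and the leading coefficients of $f,g$ have the same sign, or $f\preceq g$ and the leading coefficients of $f,g$ have opposite sign. In particular $\mathscr{P}_n\ll\mathscr{P}_{n+1}$ includes that both are real-rooted. *)

theory Defs
  imports "HOL-Computational_Algebra.Computational_Algebra"
begin

definition hurwitz_stable :: "complex poly \<Rightarrow> bool" where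
  "hurwitz_stable f \<longleftrightarrow> f = 0 \<or> (\<forall>z. Re z > 0 \<longrightarrow> poly f z \<noteq> 0)"

(* The zero polynomial is not real-rooted; nonzero constants are. *)
definition real_rooted :: "real poly \<Rightarrow> bool" where
  "real_rooted f \<longleftrightarrow> (\<forall>z. poly (map_poly complex_of_real f) z = 0 \<longrightarrow> z \<in> \<real>)"

(* Real zeros with multiplicity, in decreasing order (for f \<noteq> 0). *)
definition zeros_desc :: "real poly \<Rightarrow> real list" where
  "zeros_desc f = rev (sorted_list_of_multiset (proots f))"

(* Lists are indexed from 0, so zeros_desc f ! i is the zero r_{i+1}. *)
definition interlaces :: "real poly \<Rightarrow> real poly \<Rightarrow> bool" (infix "\<preceq>\<^sub>I" 50) where
  "g \<preceq>\<^sub>I f \<longleftrightarrow> real_rooted f \<and> real_rooted g \<and>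
     (let r = zeros_desc f; s = zeros_desc g in
        degree f = degree g + 1 \<and>
          (\<forall>i<degree g. s ! i \<le> r ! i \<and> r ! Suc i \<le> s ! i)
      \<or> degree f = degree g \<and>
          (\<forall>i<degree f. s ! i \<le> r ! i) \<and>
          (\<forall>i. Suc i < degree f \<longrightarrow> r ! Suc i \<le> s ! i))"

definition signed_interlaces :: "real poly \<Rightarrow> real poly \<Rightarrow> bool" (infix "\<lless>\<^sub>I" 50) where
  "g \<lless>\<^sub>I f \<longleftrightarrow>
     g \<preceq>\<^sub>I f \<and> sgn (lead_coeff g) = sgn (lead_coeff f) \<or>
     f \<preceq>\<^sub>I g \<and> sgn (lead_coeff g) = - sgn (lead_coeff f)"

(* Weak sign: zero is compatible with both signs. *)
definition same_sign :: "real set \<Rightarrow> bool" where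
  "same_sign A \<longleftrightarrow> (\<forall>y\<in>A. 0 \<le> y) \<or> (\<forall>y\<in>A. y \<le> 0)"

definition turan_poly :: "(nat \<Rightarrow> real poly) \<Rightarrow> nat \<Rightarrow> real poly" where
  "turan_poly P n = (P (n + 1))\<^sup>2 - P (n + 2) * P n"

end

theory Submission
  imports Defs
begin

text \<open>
  Put \<open>m = n + 1\<close>. By interlacing, \<open>P\<^sub>m\<^sub>-\<^sub>1 / P\<^sub>m = (\<Sum>k. c\<^sub>k / (x - r\<^sub>k))\<close> with \<open>c\<^sub>k \<ge> 0\<close>. Writing
  \<open>Q\<^sub>k = P\<^sub>m / (x - r\<^sub>k)\<close>, the two recurrences for \<open>P\<^sub>m\<close> and \<open>P\<^sub>m\<^sub>+\<^sub>1\<close> give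
  \<open>P\<^sub>m\<^sup>2 - P\<^sub>m\<^sub>+\<^sub>1 P\<^sub>m\<^sub>-\<^sub>1 = - (\<Sum>k. c\<^sub>k Q\<^sub>k\<^sup>2 ((x - r\<^sub>k) (p\<^sub>m - p\<^sub>m\<^sub>-\<^sub>1) + q))
    = - h\<^sub>m P\<^sub>m\<^sup>2 (\<Sum>k. c\<^sub>k (a\<^sub>0 / (x - r\<^sub>k)\<^sup>2 + a\<^sub>1 / (x - r\<^sub>k) + a\<^sub>2 + a\<^sub>3 (x - r\<^sub>k)))\<close>.
  If \<open>a\<^sub>0, a\<^sub>1, -a\<^sub>3\<close> are nonnegative, not all zero, then on the right half-plane the imaginary part of
  the last sum has the sign opposite to that of \<open>Im x\<close>, and the sum is strictly decreasing on the
  positive reals, where the hypothesis on the values forbids a change of sign.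
\<close>

subsection \<open>Complex evaluation of real polynomials\<close>

abbreviation cpoly :: "real poly \<Rightarrow> complex \<Rightarrow> complex" where
  "cpoly p \<equiv> poly (map_poly complex_of_real p)"

lemma cpoly_pCons: "cpoly (pCons a p) z = of_real a + z * cpoly p z"
  by (simp add: map_poly_pCons)

lemma cpoly_smult: "cpoly (smult a p) z = of_real a * cpoly p z"
  by (simp add: map_poly_smult)

lemma cpoly_add: "cpoly (p + q) z = cpoly p z + cpoly q z"
  by (induction p q rule: poly_induct2) (simp_all add: cpoly_pCons algebra_simps)

lemma cpoly_mult: "cpoly (p * q) z = cpoly p z * cpoly q z"
  by (induction p) (simp_all add: cpoly_pCons cpoly_add cpoly_smult algebra_simps)

lemma cpoly_power: "cpoly (p ^ n) z = cpoly p z ^ n"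
  by (induction n) (simp_all add: cpoly_mult)

lemma cpoly_sum: "cpoly (\<Sum>i\<in>A. f i) z = (\<Sum>i\<in>A. cpoly (f i) z)"
  by (induction A rule: infinite_finite_induct) (simp_all add: cpoly_add)

lemma cpoly_of_real: "cpoly p (of_real x) = of_real (poly p x)"
  by (induction p) (simp_all add: cpoly_pCons)

lemmas cpoly_simps = cpoly_pCons cpoly_smult cpoly_add cpoly_mult cpoly_power cpoly_sum

lemma hurwitz_stable_of_real:
  "hurwitz_stable (map_poly complex_of_real p) \<longleftrightarrow> p = 0 \<or> (\<forall>z. Re z > 0 \<longrightarrow> cpoly p z \<noteq> 0)"
  by (auto simp: hurwitz_stable_def map_poly_eq_0_iff)

lemma hurwitz_stable_of_real_minus:
  "hurwitz_stable (map_poly complex_of_real (- p)) \<longleftrightarrow> hurwitz_stable (map_poly complex_of_real p)"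
  using cpoly_smult[of "-1" p] by (simp add: hurwitz_stable_of_real)

subsection \<open>Partial fractions of interlacing polynomials\<close>

lemma smult_sum_right: "smult a (\<Sum>i\<in>A. f i) = (\<Sum>i\<in>A. smult a (f i))"
  by (induction A rule: infinite_finite_induct) (simp_all add: smult_add_right)

section \<open>Factorization of polynomials that split into linear factors\<close>

lemma prod_proots_dvd: "(\<Prod>x\<in>#proots p. [:-x, 1:]) dvd (p :: 'a :: idom poly)"
proof (cases "p = 0")
  case False
  then show ?thesis
  proof (induction "degree p" arbitrary: p rule: less_induct)
    case less
    show ?case
    proof (cases "\<exists>x. poly p x = 0")
      case False
      with less.prems have "proots p = {#}"
        by (simp add: multiset_eqI order_root)
      then show ?thesis by simp
    next
      case True
      then obtain x g where p: "p = [:-x, 1:] * g"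
        by (auto simp only: poly_eq_0_iff_dvd dvd_def)
      with less.prems have g: "g \<noteq> 0"
        by auto
      hence "degree g < degree p"
        unfolding p by (subst degree_mult_eq) auto
      hence "(\<Prod>x\<in>#proots g. [:-x, 1:]) dvd g"
        using less.hyps g by blast
      moreover have "proots p = {#x#} + proots g"
        unfolding p using g by (subst proots_mult) auto
      ultimately show ?thesis
        unfolding p by (simp only: image_mset_union prod_mset.union image_mset_single
            prod_mset_singleton mult_dvd_mono dvd_refl)
    qed
  qed
qed simp

text \<open>The product over the root multiset divides \<open>p\<close> and is monic. If it also has
  the degree of \<open>p\<close>, the cofactor is constant and must be the leading
  coefficient.\<close>

lemma split_polynomial_eq_prod_proots:
  fixes p :: "'a :: field poly"
  assumes "p \<noteq> 0" "size (proots p) = degree p"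
  shows "p = smult (lead_coeff p) (\<Prod>x\<in>#proots p. [:-x, 1:])" (is "_ = smult _ ?R")
proof -
  obtain g where g: "p = ?R * g"
    using prod_proots_dvd by (rule dvdE)
  have monic: "lead_coeff (\<Prod>x\<in>#M. [:-x, 1:]) = 1" for M :: "'a multiset"
  proof (induction M)
    case (add x M)
    then show ?case
      by (simp only: image_mset_add_mset prod_mset.add_mset lead_coeff_mult) simp
  qed simp
  have "degree (\<Prod>x\<in>#M. [:-x, 1:]) = size M" for M :: "'a multiset"
  proof (induction M)
    case (add x M)
    then show ?case
      using degree_mult_eq[of "[:-x, 1:]" "\<Prod>x\<in>#M. [:-x, 1:]"] monic[of M]
      by (cases "(\<Prod>x\<in>#M. [:-x, 1:]) = 0") (simp_all del: mult_pCons_left)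
  qed simp
  with monic have R: "lead_coeff ?R = 1" "degree ?R = degree p"
    using assms(2) by metis+
  have "?R \<noteq> 0" "g \<noteq> 0"
    using assms(1) g by auto
  hence "degree g = 0"
    using R(2) degree_mult_eq[of ?R g] by (simp flip: g)
  then obtain u where "g = [:u:]"
    by (rule degree_eq_zeroE)
  with g have p: "p = smult u ?R"
    by simp
  moreover have "lead_coeff p = u"
    using R(1) lead_coeff_smult[of u ?R] by (simp flip: p)
  ultimately show ?thesis
    by metis
qed

lemma split_polynomial_eq_prod_zeros_desc:
  assumes "p \<noteq> 0" "size (proots p) = degree p"
  shows "p = smult (lead_coeff p) (\<Prod>i<degree p. [:- (zeros_desc p ! i), 1:])"
proof -
  have mset: "mset (zeros_desc p) = proots p"
    by (simp add: zeros_desc_def)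
  hence len: "length (zeros_desc p) = degree p"
    using assms(2) by (metis size_mset)
  have "(\<Prod>x\<in>#proots p. [:-x, 1:]) = prod_list (map (\<lambda>x. [:-x, 1:]) (zeros_desc p))"
    by (metis mset mset_map prod_mset_prod_list)
  also have "\<dots> = (\<Prod>i<degree p. [:- (zeros_desc p ! i), 1:])"
    by (subst prod.list_conv_set_nth) (simp add: len atLeast0LessThan)
  finally show ?thesis
    using split_polynomial_eq_prod_proots[OF assms] by simp
qed

section \<open>Nonnegative coefficients from interlacing\<close>

lemma interlacing_partial_fractions:
  fixes r s :: "nat \<Rightarrow> real"
  assumes "\<And>i. i < n \<Longrightarrow> s i \<le> r i \<and> r (Suc i) \<le> s i"
  shows "\<exists>c Q. (\<forall>i\<le>n. 0 \<le> c i \<and> [:- r i, 1:] * Q i = (\<Prod>j\<le>n. [:- r j, 1:])) \<and>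
    (\<Prod>i<n. [:- s i, 1:]) = (\<Sum>i\<le>n. smult (c i) (Q i))"
  using assms
proof (induction n)
  case 0
  show ?case
    by (intro exI[of _ "\<lambda>_. 1"]) simp
next
  case (Suc n)
  let ?f = "\<Prod>j\<le>n. [:- r j, 1:]" and ?L = "\<lambda>t::real. [:- t, 1:]"
  obtain c Q where c: "\<And>i. i \<le> n \<Longrightarrow> 0 \<le> c i" and Q: "\<And>i. i \<le> n \<Longrightarrow> ?L (r i) * Q i = ?f"
    and eq: "(\<Prod>i<n. ?L (s i)) = (\<Sum>i\<le>n. smult (c i) (Q i))"
    using Suc.IH[OF Suc.prems[OF less_SucI]] by blast
  have "r n \<le> r i" if "i \<le> n" for i
    using that
  proof (induction rule: inc_induct)
    case (step k)
    then show ?case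
      using Suc.prems[of k] by force
  qed simp
  hence between: "r (Suc n) \<le> s n \<and> s n \<le> r i" if "i \<le> n" for i
    using that Suc.prems[of n] by fastforce
  \<comment> \<open>\<open>s n\<close> is a convex combination of \<open>r (Suc n)\<close> and \<open>r i\<close>, so multiplying \<open>1 / (x - r i)\<close> by
    \<open>(x - s n) / (x - r (Suc n))\<close> splits it into two fractions with nonnegative coefficients.\<close>
  have "\<exists>t. 0 \<le> t \<and> t \<le> 1 \<and> s n = t * r (Suc n) + (1 - t) * r i" if "i \<le> n" for i
  proof (cases "r i = r (Suc n)")
    case True
    then show ?thesis
      using between[OF that] by (intro exI[of _ 0]) auto
  next
    case False
    with between[OF that] have "r i - r (Suc n) > 0"
      by simp
    define t where "t = (r i - s n) / (r i - r (Suc n))"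
    with \<open>r i - r (Suc n) > 0\<close> have "t * (r i - r (Suc n)) = r i - s n" "0 \<le> t" "t \<le> 1"
      using between[OF that] by simp_all
    then show ?thesis
      by (intro exI[of _ t]) (simp add: algebra_simps)
  qed
  then obtain t where t: "\<And>i. i \<le> n \<Longrightarrow> 0 \<le> t i \<and> t i \<le> 1 \<and> s n = t i * r (Suc n) + (1 - t i) * r i"
    by metis
  \<comment> \<open>Since x - s n = t i (x - r (Suc n)) + (1 - t i) (x - r i), the fraction at
    \<open>r i\<close> keeps the share \<open>t i\<close>. The shares \<open>1 - t i\<close> of all
    old fractions are collected in the new one at \<open>r (Suc n)\<close>. Working by index instead
    of with residues lets zeros coincide.\<close>
  define c' where "c' i = (if i \<le> n then c i * t i else (\<Sum>i\<le>n. c i * (1 - t i)))" for i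
  define Q' where "Q' i = (if i \<le> n then Q i * ?L (r (Suc n)) else ?f)" for i
  have split: "smult (c i) (Q i) * ?L (s n) = smult (c' i) (Q' i) + smult (c i * (1 - t i)) ?f"
    if "i \<le> n" for i
  proof -
    have L: "?L (s n) = smult (t i) (?L (r (Suc n))) + smult (1 - t i) (?L (r i))"
      using t[OF that] by simp
    show ?thesis
      unfolding c'_def Q'_def Q[OF that, symmetric] L using that
      by (simp add: algebra_simps smult_add_right smult_diff_left del: mult_pCons_left mult_pCons_right
          smult_pCons)
  qed
  have "(\<Prod>i<Suc n. ?L (s i)) = (\<Sum>i\<le>n. smult (c i) (Q i) * ?L (s n))"
    by (simp only: prod.lessThan_Suc eq sum_distrib_right)
  also have "\<dots> = (\<Sum>i\<le>n. smult (c' i) (Q' i) + smult (c i * (1 - t i)) ?f)"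
    by (intro sum.cong refl split) simp
  also have "\<dots> = (\<Sum>i\<le>n. smult (c' i) (Q' i)) + smult (\<Sum>i\<le>n. c i * (1 - t i)) ?f"
    by (simp only: sum.distrib smult_sum)
  also have "\<dots> = (\<Sum>i\<le>Suc n. smult (c' i) (Q' i))"
    by (simp add: c'_def Q'_def)
  finally have 1: "(\<Prod>i<Suc n. ?L (s i)) = (\<Sum>i\<le>Suc n. smult (c' i) (Q' i))" .
  have "0 \<le> c' i \<and> ?L (r i) * Q' i = (\<Prod>j\<le>Suc n. ?L (r j))" if "i \<le> Suc n" for i
  proof (cases "i \<le> n")
    case True
    have "?L (r i) * Q' i = (?L (r i) * Q i) * ?L (r (Suc n))"
      using True by (simp only: Q'_def if_True mult.assoc)
    then show ?thesis
      using True c t by (simp only: Q prod.atMost_Suc) (simp add: c'_def)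
  next
    case False
    with that have "i = Suc n"
      by simp
    then show ?thesis
      using c t by (simp only: Q'_def prod.atMost_Suc)
        (auto simp: c'_def mult.commute simp del: mult_pCons_left mult_pCons_right intro!: sum_nonneg)
  qed
  with 1 show ?case
    by blast
qed

text \<open>The \<open>size\<close> assumptions say that both polynomials split over the reals,
  which reduces the claim to monic products. Equal signs of the leading coefficients make their
  quotient nonnegative, so rescaling preserves the signs of the coefficients.\<close>

lemma interlaces_partial_fractions:
  assumes "g \<preceq>\<^sub>I f" "degree f = Suc (degree g)" "sgn (lead_coeff g) = sgn (lead_coeff f)"
    and sizes: "size (proots f) = degree f" "size (proots g) = degree g"
  obtains c \<rho> :: "nat \<Rightarrow> real" and Q :: "nat \<Rightarrow> real poly"
  where "\<forall>i<degree f. 0 \<le> c i" "\<forall>i<degree f. [:- \<rho> i, 1:] * Q i = f"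
    "g = (\<Sum>i<degree f. smult (c i) (Q i))"
proof -
  define r where "r i = zeros_desc f ! i" for i
  define s where "s i = zeros_desc g ! i" for i
  have nz: "f \<noteq> 0" "g \<noteq> 0"
  proof -
    show "f \<noteq> 0"
      using assms(2) by auto
    then show "g \<noteq> 0"
      using assms(3) by (metis leading_coeff_0_iff sgn_eq_0_iff)
  qed
  have f: "f = smult (lead_coeff f) (\<Prod>i\<le>degree g. [:- r i, 1:])"
    using split_polynomial_eq_prod_zeros_desc[OF nz(1) sizes(1)]
    by (simp only: assms(2) r_def lessThan_Suc_atMost)
  have g: "g = smult (lead_coeff g) (\<Prod>i<degree g. [:- s i, 1:])"
    using split_polynomial_eq_prod_zeros_desc[OF nz(2) sizes(2)] by (simp only: s_def)
  have "\<forall>i<degree g. s i \<le> r i \<and> r (Suc i) \<le> s i"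
    using assms(1,2) by (auto simp: interlaces_def Let_def r_def s_def)
  then obtain c Q where c: "\<And>i. i \<le> degree g \<Longrightarrow> 0 \<le> c i"
    and Q: "\<And>i. i \<le> degree g \<Longrightarrow> [:- r i, 1:] * Q i = (\<Prod>j\<le>degree g. [:- r j, 1:])"
    and eq: "(\<Prod>i<degree g. [:- s i, 1:]) = (\<Sum>i\<le>degree g. smult (c i) (Q i))"
    using interlacing_partial_fractions[of "degree g" s r] by auto
  let ?u = "lead_coeff g / lead_coeff f"
  have u: "0 \<le> ?u"
    using assms(3) nz by (auto simp: sgn_if zero_le_divide_iff split: if_splits)
  \<comment> \<open>\<open>lead_coeff f\<close> goes into the quotients \<open>Q i\<close> and
    \<open>?u\<close> into the coefficients; their product is \<open>lead_coeff g\<close>.\<close>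
  show thesis
  proof (rule that)
    show "\<forall>i<degree f. 0 \<le> ?u * c i"
      using u c assms(2) by (metis mult_nonneg_nonneg less_Suc_eq_le)
    show "\<forall>i<degree f. [:- r i, 1:] * smult (lead_coeff f) (Q i) = f"
      using assms(2) f Q by (metis mult_smult_right less_Suc_eq_le)
    show "g = (\<Sum>i<degree f. smult (?u * c i) (smult (lead_coeff f) (Q i)))"
    proof -
      have "smult (?u * c i) (smult (lead_coeff f) (Q i)) = smult (lead_coeff g) (smult (c i) (Q i))" for i
        using nz by simp
      then show ?thesis
        using g unfolding assms(2) eq lessThan_Suc_atMost smult_sum_right by simp
    qed
  qed
qed

subsection \<open>Stability\<close>

text \<open>Used with \<open>y\<close> as x - \<rho>: over the complex numbers with \<open>w\<close>
  the value of \<open>Q i\<close>, so that \<open>y * w\<close> is the value of \<open>f\<close>,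
  and over the reals with \<open>w\<close> equal to 1.\<close>

lemma cubic_eq_square_mult:
  fixes y :: "'a :: field"
  assumes "y \<noteq> 0"
  shows "w\<^sup>2 * (b0 + b1 * y + b2 * y\<^sup>2 + b3 * y ^ 3) = (y * w)\<^sup>2 * (b0 / y\<^sup>2 + b1 / y + b2 + b3 * y)"
  using assms by (simp add: field_simps power2_eq_square power3_eq_cube)

text \<open>Both 1/y and 1/y^2 have imaginary part -Im y times a real factor, which is nonnegative
  when Re y > 0. The constant \<open>b 2\<close> drops out, so its sign is free.\<close>

lemma Im_term:
  fixes b :: "nat \<Rightarrow> real"
  assumes "y \<noteq> 0"
  shows "Im (of_real (b 0) / y\<^sup>2 + of_real (b 1) / y + of_real (b 2) + of_real (b 3) * y) =
    - Im y * (2 * b 0 * Re y / cmod y ^ 4 + b 1 / (cmod y)\<^sup>2 - b 3)"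
proof -
  define w where "w = inverse y"
  have *: "of_real (b 0) / y\<^sup>2 = of_real (b 0) * w\<^sup>2" "of_real (b 1) / y = of_real (b 1) * w"
    by (simp_all add: w_def field_simps)
  have w: "Re w = Re y / (cmod y)\<^sup>2" "Im w = - Im y / (cmod y)\<^sup>2"
    by (simp_all add: w_def complex_inverse cmod_power2)
  have "cmod y > 0"
    using assms by simp
  have "Im (w\<^sup>2) = - 2 * Im y * Re y / cmod y ^ 4"
    by (simp add: power2_eq_square[of w] w power4_eq_xxxx power2_eq_square)
  then show ?thesis
    unfolding * by (simp add: w algebra_simps)
qed

text \<open>After division by the square of \<open>f\<close>, a sum \<Phi> of rational terms
  remains. Off the real axis its imaginary part is nonzero; on the positive axis it is strictly
  decreasing, and a zero would force a sign change that \<open>vals\<close> and the stability of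
  \<open>h\<close> exclude.\<close>

lemma hurwitz_stable_sum_nonneg:
  fixes b :: "'i \<Rightarrow> nat \<Rightarrow> real" and \<rho> :: "'i \<Rightarrow> real" and h f :: "real poly"
  defines "G \<equiv> \<lambda>i. \<Sum>j=0..3. smult (b i j) ([:- \<rho> i, 1:] ^ j)"
  assumes fin: "finite A"
    and f: "\<And>z. 0 < Re z \<Longrightarrow> cpoly f z \<noteq> 0"
    and Q: "\<And>i. i \<in> A \<Longrightarrow> [:- \<rho> i, 1:] * Q i = f"
    and rho: "\<And>i. i \<in> A \<Longrightarrow> \<rho> i \<le> 0"
    and b: "\<And>i. i \<in> A \<Longrightarrow> 0 \<le> b i 0 \<and> 0 \<le> b i 1 \<and> b i 3 \<le> 0"
    and h: "hurwitz_stable (map_poly complex_of_real h)"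
    and vals: "same_sign {poly h x * poly (G i) x | i x. i \<in> A \<and> x > 0}"
  shows "hurwitz_stable (map_poly complex_of_real (h * (\<Sum>i\<in>A. (Q i)\<^sup>2 * G i)))"
proof (cases "h = 0")
  case True
  then show ?thesis
    by (simp add: hurwitz_stable_def)
next
  case False
  have hz: "cpoly h z \<noteq> 0" if "0 < Re z" for z
    using h False that by (simp add: hurwitz_stable_of_real)
  have G: "G i = [:b i 0:] + smult (b i 1) [:- \<rho> i, 1:] + smult (b i 2) ([:- \<rho> i, 1:]\<^sup>2)
      + smult (b i 3) ([:- \<rho> i, 1:] ^ 3)" for i
    unfolding G_def by (simp add: numeral_3_eq_3 numeral_2_eq_2 smult_1_left one_pCons)
  show ?thesis
  proof (cases "\<forall>i\<in>A. b i 0 = 0 \<and> b i 1 = 0 \<and> b i 3 = 0")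
    \<comment> \<open>Neither strict argument applies in this degenerate case: \<Phi> is constant,
      and the sum is a constant multiple of the square of \<open>f\<close>.\<close>
    case True
    have "(\<Sum>i\<in>A. (Q i)\<^sup>2 * G i) = (\<Sum>i\<in>A. smult (b i 2) (f\<^sup>2))"
    proof (rule sum.cong)
      fix i assume i: "i \<in> A"
      have "(Q i)\<^sup>2 * G i = smult (b i 2) (([:- \<rho> i, 1:] * Q i)\<^sup>2)"
        unfolding G power_mult_distrib using True i by (simp only: mult_smult_right) (simp add: mult.commute)
      then show "(Q i)\<^sup>2 * G i = smult (b i 2) (f\<^sup>2)"
        using Q[OF i] by simp
    qed simp
    also have "\<dots> = smult (\<Sum>i\<in>A. b i 2) (f\<^sup>2)"
      by (simp add: smult_sum)
    finally obtain B where "h * (\<Sum>i\<in>A. (Q i)\<^sup>2 * G i) = smult B (h * f\<^sup>2)"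
      by (metis mult_smult_right)
    then show ?thesis
      using f hz by (cases "B = 0") (simp_all add: hurwitz_stable_of_real cpoly_simps)
  next
    \<comment> \<open>The index \<open>i0\<close> supplies the strictness both for the imaginary
      part and for the monotonicity.\<close>
    case False
    then obtain i0 where i0: "i0 \<in> A" "b i0 0 \<noteq> 0 \<or> b i0 1 \<noteq> 0 \<or> b i0 3 \<noteq> 0"
      by blast
    define \<Phi> where "\<Phi> z = (\<Sum>i\<in>A. of_real (b i 0) / (z - of_real (\<rho> i))\<^sup>2
      + of_real (b i 1) / (z - of_real (\<rho> i)) + of_real (b i 2)
      + of_real (b i 3) * (z - of_real (\<rho> i)))" for z :: complex
    define \<phi> where "\<phi> i x = b i 0 / (x - \<rho> i)\<^sup>2 + b i 1 / (x - \<rho> i) + b i 2 + b i 3 * (x - \<rho> i)" for i x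
    have eval: "cpoly (\<Sum>i\<in>A. (Q i)\<^sup>2 * G i) z = (cpoly f z)\<^sup>2 * \<Phi> z" if z: "0 < Re z" for z
      unfolding \<Phi>_def cpoly_sum sum_distrib_left
    proof (rule sum.cong)
      fix i assume i: "i \<in> A"
      let ?y = "z - of_real (\<rho> i)"
      have y: "?y \<noteq> 0"
        using rho[OF i] z by (auto simp: complex_eq_iff)
      have "cpoly f z = ?y * cpoly (Q i) z"
        unfolding Q[OF i, symmetric] by (simp only: cpoly_simps) simp
      moreover have "cpoly (G i) z = of_real (b i 0) + of_real (b i 1) * ?y
          + of_real (b i 2) * ?y\<^sup>2 + of_real (b i 3) * ?y ^ 3"
        unfolding G by (simp only: cpoly_simps) simp
      ultimately show "cpoly ((Q i)\<^sup>2 * G i) z = (cpoly f z)\<^sup>2 * (of_real (b i 0) / ?y\<^sup>2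
          + of_real (b i 1) / ?y + of_real (b i 2) + of_real (b i 3) * ?y)"
        unfolding cpoly_mult cpoly_power using cubic_eq_square_mult[OF y] by simp
    qed simp
    have "\<Phi> z \<noteq> 0" if z: "0 < Re z" for z
    proof (cases "Im z = 0")
      case False
      let ?K = "\<lambda>i. 2 * b i 0 * Re (z - of_real (\<rho> i)) / cmod (z - of_real (\<rho> i)) ^ 4
        + b i 1 / (cmod (z - of_real (\<rho> i)))\<^sup>2 - b i 3"
      have pos: "0 < Re (z - of_real (\<rho> i))" "0 < cmod (z - of_real (\<rho> i))" if "i \<in> A" for i
      proof -
        show "0 < Re (z - of_real (\<rho> i))"
          using rho[OF that] z by simp
        thus "0 < cmod (z - of_real (\<rho> i))"
          by (metis less_irrefl norm_eq_zero zero_complex.sel(1) zero_less_norm_iff)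
      qed
      \<comment> \<open>Replacing \<open>b i 3\<close> by 0 can only lower the value, and the other
        two summands are nonnegative.\<close>
      have K: "0 \<le> ?K i" if "i \<in> A" for i
        using pos[OF that] b[OF that]
        by (intro order.trans[OF _ diff_mono[OF order_refl, of "b i 3" 0]]) (auto intro!: add_nonneg_nonneg)
      have "0 \<le> 2 * b i0 0 * Re (z - of_real (\<rho> i0)) / cmod (z - of_real (\<rho> i0)) ^ 4"
        "0 \<le> b i0 1 / (cmod (z - of_real (\<rho> i0)))\<^sup>2"
        using pos[OF i0(1)] b[OF i0(1)] by auto
      moreover have "2 * b i0 0 * Re (z - of_real (\<rho> i0)) / cmod (z - of_real (\<rho> i0)) ^ 4 \<noteq> 0 \<or>
        b i0 1 / (cmod (z - of_real (\<rho> i0)))\<^sup>2 \<noteq> 0 \<or> b i0 3 \<noteq> 0"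
        using pos[OF i0(1)] i0(2) by auto
      ultimately have K0: "0 < ?K i0"
        using b[OF i0(1)] by linarith
      have "Im (\<Phi> z) = (\<Sum>i\<in>A. - Im z * ?K i)"
        unfolding \<Phi>_def Im_sum
      proof (rule sum.cong)
        fix i assume "i \<in> A"
        then have "z - of_real (\<rho> i) \<noteq> 0"
          using pos by fastforce
        then show "Im (of_real (b i 0) / (z - of_real (\<rho> i))\<^sup>2 + of_real (b i 1) / (z - of_real (\<rho> i))
          + of_real (b i 2) + of_real (b i 3) * (z - of_real (\<rho> i))) = - Im z * ?K i"
          by (subst Im_term) simp_all
      qed simp
      also have "\<dots> = - Im z * (\<Sum>i\<in>A. ?K i)"
        by (simp only: sum_distrib_left)
      finally have "Im (\<Phi> z) = - Im z * (\<Sum>i\<in>A. ?K i)" .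
      moreover have "(\<Sum>i\<in>A. ?K i) > 0"
        using fin i0(1) K K0 by (intro sum_pos2) auto
      ultimately show ?thesis
        using False by auto
    next
      case True
      let ?x = "Re z"
      have \<Phi>: "\<Phi> (of_real x) = of_real (\<Sum>i\<in>A. \<phi> i x)" for x
        by (simp add: \<Phi>_def \<phi>_def)
      have mono: "\<phi> i y \<le> \<phi> i x \<and> (b i 0 \<noteq> 0 \<or> b i 1 \<noteq> 0 \<or> b i 3 \<noteq> 0 \<longrightarrow> \<phi> i y < \<phi> i x)"
        if i: "i \<in> A" and xy: "0 < x" "x < y" for i x y
      proof -
        let ?x = "x - \<rho> i" and ?y = "y - \<rho> i"
        have lt: "0 < ?x" "?x < ?y"
          using xy rho[OF i] by auto
        hence sq: "0 < ?x\<^sup>2" "?x\<^sup>2 < ?y\<^sup>2"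
          by (auto intro: power_strict_mono)
        have 0: "b i 0 / ?y\<^sup>2 \<le> b i 0 / ?x\<^sup>2" "b i 0 \<noteq> 0 \<Longrightarrow> b i 0 / ?y\<^sup>2 < b i 0 / ?x\<^sup>2"
          using b[OF i] sq by (auto intro!: divide_left_mono divide_strict_left_mono mult_pos_pos)
        have 1: "b i 1 / ?y \<le> b i 1 / ?x" "b i 1 \<noteq> 0 \<Longrightarrow> b i 1 / ?y < b i 1 / ?x"
          using b[OF i] lt by (auto intro!: divide_left_mono divide_strict_left_mono mult_pos_pos)
        have 2: "b i 3 * ?y \<le> b i 3 * ?x" "b i 3 \<noteq> 0 \<Longrightarrow> b i 3 * ?y < b i 3 * ?x"
          using b[OF i] lt by (auto intro!: mult_left_mono_neg mult_strict_left_mono_neg)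
        show ?thesis
          using 0 1 2 unfolding \<phi>_def by linarith
      qed
      have decr: "(\<Sum>i\<in>A. \<phi> i y) < (\<Sum>i\<in>A. \<phi> i x)" if "0 < x" "x < y" for x y
        using fin i0 mono that by (intro sum_strict_mono_ex1) blast+
      have eval_real: "poly (G i) x = (x - \<rho> i)\<^sup>2 * \<phi> i x" "0 < (x - \<rho> i)\<^sup>2"
        if "i \<in> A" "0 < x" for i x
      proof -
        have "x - \<rho> i \<noteq> 0"
          using rho[OF that(1)] that(2) by auto
        then show "poly (G i) x = (x - \<rho> i)\<^sup>2 * \<phi> i x" "0 < (x - \<rho> i)\<^sup>2"
          unfolding G \<phi>_def poly_add poly_smult poly_power
          using cubic_eq_square_mult[of "x - \<rho> i" 1] by simp_all
      qed
      obtain s :: real where s: "s \<noteq> 0"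
        "\<And>i x. i \<in> A \<Longrightarrow> 0 < x \<Longrightarrow> 0 \<le> s * (poly h x * poly (G i) x)"
      proof -
        from vals consider "\<And>i x. i \<in> A \<Longrightarrow> 0 < x \<Longrightarrow> 0 \<le> 1 * (poly h x * poly (G i) x)"
          | "\<And>i x. i \<in> A \<Longrightarrow> 0 < x \<Longrightarrow> 0 \<le> (-1) * (poly h x * poly (G i) x)"
          unfolding same_sign_def by fastforce
        then show thesis
          by cases (rule that[rotated], assumption+, simp)+
      qed
      \<comment> \<open>Each value of \<open>G i\<close> is a positive square times \<phi>, so the
        common sign passes to every term \<phi> and hence to the sum.\<close>
      have sgn_sum: "0 \<le> (s * poly h x) * (\<Sum>i\<in>A. \<phi> i x)" if x: "0 < x" for x
        unfolding sum_distrib_left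
      proof (rule sum_nonneg)
        fix i assume i: "i \<in> A"
        have "0 \<le> (x - \<rho> i)\<^sup>2 * (s * poly h x * \<phi> i x)"
          using s(2)[OF i x] unfolding eval_real(1)[OF i x] by (simp only: mult_ac)
        then show "0 \<le> s * poly h x * \<phi> i x"
          using eval_real(2)[OF i x] by (simp add: zero_le_mult_iff)
      qed
      have hx: "poly h x \<noteq> 0" if "0 < x" for x
        using hz[of "of_real x"] that by (simp add: cpoly_of_real)
      have "(\<Sum>i\<in>A. \<phi> i ?x) \<noteq> 0"
      proof
        assume 0: "(\<Sum>i\<in>A. \<phi> i ?x) = 0"
        \<comment> \<open>The factors 1/2 and 2 only serve to pick positive points on either side of
          \<open>?x\<close>. The sum changes sign between them, so \<open>h\<close> must too, and
          the intermediate value theorem gives \<open>h\<close> a positive zero.\<close>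
        have "0 < (\<Sum>i\<in>A. \<phi> i (?x / 2))" "(\<Sum>i\<in>A. \<phi> i (?x * 2)) < 0"
          using decr[of "?x / 2" ?x] decr[of ?x "?x * 2"] 0 z by simp_all
        with sgn_sum[of "?x / 2"] sgn_sum[of "?x * 2"] z
        have "0 \<le> s * poly h (?x / 2)" "s * poly h (?x * 2) \<le> 0"
          by (auto simp: zero_le_mult_iff)
        with s(1) hx[of "?x / 2"] hx[of "?x * 2"] z
        have "poly h (?x / 2) * poly h (?x * 2) < 0"
          by (auto simp: zero_le_mult_iff mult_le_0_iff mult_less_0_iff)
        then show False
          using poly_IVT[of "?x / 2" "?x * 2" h] hx z by fastforce
      qed
      moreover have "z = of_real ?x"
        using True by (simp add: complex_eq_iff)
      ultimately show ?thesis
        using \<Phi>[of ?x] by (metis of_real_eq_0_iff)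
    qed
    then show ?thesis
      using eval f hz by (auto simp: hurwitz_stable_of_real cpoly_mult)
  qed
qed

text \<open>Carries the sign hypothesis on the given values over to the weighted ones: the
  nonnegative weight \<open>t\<close> may vary, while the factor \<sigma> of either sign is common
  to all.\<close>

lemma same_sign_scaled:
  assumes "same_sign S" and V: "\<And>v. v \<in> V \<Longrightarrow> \<exists>w\<in>S. \<exists>t\<ge>0. v = \<sigma> * (t * w)"
  shows "same_sign V"
proof -
  have "(\<forall>w\<in>S. 0 \<le> \<sigma> * w) \<or> (\<forall>w\<in>S. \<sigma> * w \<le> 0)"
    using assms(1) linear[of 0 \<sigma>] unfolding same_sign_def
    by (meson mult_nonneg_nonneg mult_nonneg_nonpos mult_nonpos_nonneg mult_nonpos_nonpos)
  moreover have "\<exists>w\<in>S. \<exists>t\<ge>0. v = t * (\<sigma> * w)" if "v \<in> V" for v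
    using V[OF that] by (simp only: mult.left_commute)
  ultimately show ?thesis
    unfolding same_sign_def by (metis mult_nonneg_nonneg mult_nonneg_nonpos)
qed

section \<open>The Turan expression and the final assembly\<close>

lemma poly_pos_of_nonneg_coeffs:
  fixes f :: "real poly"
  assumes "f \<noteq> 0" "\<And>i. 0 \<le> coeff f i" "0 < x"
  shows "0 < poly f x"
  unfolding poly_altdef
proof (rule sum_pos2[of _ "degree f"])
  have "0 < coeff f (degree f)"
    using assms(1) assms(2)[of "degree f"] by (simp add: order_less_le)
  then show "0 < coeff f (degree f) * x ^ degree f"
    using assms(3) by simp
  show "0 \<le> coeff f i * x ^ i" for i
    using assms(2)[of i] assms(3) by simp
qed simp_all

text \<open>Once the recurrences are substituted, the expression is linear in \<open>G\<close> and
  its derivative, so it can be expanded along the partial fractions of \<open>G\<close>.\<close>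

lemma turan_identity:
  fixes F G H p1 p0 q :: "real poly"
  assumes F: "F = p0 * G + q * pderiv G" and H: "H = p1 * F + q * pderiv F"
    and Q: "\<And>i. i \<in> A \<Longrightarrow> [:- \<rho> i, 1:] * Q i = F"
    and G: "G = (\<Sum>i\<in>A. smult (c i) (Q i))"
  shows "F\<^sup>2 - H * G = - (\<Sum>i\<in>A. smult (c i) ((Q i)\<^sup>2 * ([:- \<rho> i, 1:] * (p1 - p0) + q)))"
proof -
  \<comment> \<open>Only one of the two factors \<open>F\<close> of the square is replaced by its
    recurrence.\<close>
  have "F\<^sup>2 - H * G = F * (p0 * G + q * pderiv G) - (p1 * F + q * pderiv F) * G"
    unfolding H by (simp add: power2_eq_square flip: F)
  also have "\<dots> = - (F * G * (p1 - p0) + q * (pderiv F * G - F * pderiv G))"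
    by (simp add: algebra_simps)
  also have "F * G * (p1 - p0) + q * (pderiv F * G - F * pderiv G)
      = (\<Sum>i\<in>A. smult (c i) (F * Q i * (p1 - p0) + q * (pderiv F * Q i - F * pderiv (Q i))))"
    by (simp add: G higher_pderiv_sum[of 1, simplified] pderiv_smult sum_distrib_left sum_distrib_right smult_add_right
        smult_diff_right sum.distrib sum_subtractf right_diff_distrib)
  also have "\<dots> = (\<Sum>i\<in>A. smult (c i) ((Q i)\<^sup>2 * ([:- \<rho> i, 1:] * (p1 - p0) + q)))"
  proof (intro sum.cong arg_cong[of _ _ "smult _"])
    fix i assume i: "i \<in> A"
    define L where "L = [:- \<rho> i, 1:]"
    have F': "F = L * Q i"
      using Q[OF i] by (simp only: L_def)
    \<comment> \<open>With this, the Wronskian \<open>pderiv F * Q i - F * pderiv (Q i)\<close>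
      collapses to \<open>(Q i)\<^sup>2\<close>.\<close>
    have "pderiv F = L * pderiv (Q i) + Q i"
      unfolding F' pderiv_mult by (simp add: L_def pderiv_pCons)
    then show "F * Q i * (p1 - p0) + q * (pderiv F * Q i - F * pderiv (Q i)) =
        (Q i)\<^sup>2 * ([:- \<rho> i, 1:] * (p1 - p0) + q)"
      unfolding F' L_def[symmetric] by (simp add: algebra_simps power2_eq_square)
  qed simp
  finally show ?thesis .
qed

theorem theorem3p2:
  fixes P p h :: "nat \<Rightarrow> real poly"
    and q :: "real poly"
    and r :: "nat \<Rightarrow> nat \<Rightarrow> real"
    and a :: "nat \<Rightarrow> nat \<Rightarrow> nat \<Rightarrow> real"
  assumes nonneg: "\<And>n i. 0 \<le> coeff (P n) i"
    and deg: "\<And>n. degree (P n) = n"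
    and rec: "\<And>n. P (n + 1) = p n * P n + q * pderiv (P n)"
    and interl: "\<And>n. P n \<lless>\<^sub>I P (n + 1)"
    and zeros: "\<And>n. n \<ge> 1 \<Longrightarrow> proots (P n) = image_mset (r n) (mset_set {1..n})"
    and decomp: "\<And>n k. n \<ge> 1 \<Longrightarrow> k \<in> {1..n} \<Longrightarrow>
      [:- r n k, 1:] * (p n - p (n - 1)) + q = h n * (\<Sum>i=0..3. smult (a n k i) ([:- r n k, 1:] ^ i))"
    and stable: "\<And>n. n \<ge> 1 \<Longrightarrow> hurwitz_stable (map_poly complex_of_real (h n))"
    and sign_coeffs: "\<And>n. n \<ge> 1 \<Longrightarrow> same_sign (\<Union>k\<in>{1..n}. {- a n k 3, a n k 1, a n k 0})"
    and sign_values: "\<And>n. n \<ge> 1 \<Longrightarrow>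
      same_sign {poly (h n) x * (\<Sum>i=0..3. a n k i * (x - r n k) ^ i) | k x. k \<in> {1..n} \<and> x > 0}"
  shows "\<forall>n. hurwitz_stable (map_poly complex_of_real (turan_poly P n))"
proof
  fix n :: nat
  \<comment> \<open>The decomposition is used at index \<open>m\<close>, which is at least 1;
    \<open>p (m - 1)\<close> and \<open>p m\<close> belong to the recurrences that produce
    \<open>P m\<close> and \<open>P (m + 1)\<close>.\<close>
  define m where "m = n + 1"
  have m: "m \<ge> 1" "m - 1 = n"
    by (simp_all add: m_def)
  \<comment> \<open>The degree says nothing at index 0, because the zero polynomial has degree 0
    too; a zero \<open>P k\<close> would make \<open>P (k + 1)\<close> vanish, against its positive
    degree.\<close>
  have nz: "P k \<noteq> 0" for k
  proof
    assume "P k = 0"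
    then have "P (k + 1) = 0"
      using rec[of k] by simp
    then show False
      using deg[of "k + 1"] by simp
  qed
  have lead: "sgn (lead_coeff (P k)) = 1" for k
    using nonneg[of k "degree (P k)"] nz[of k] by (simp add: order_less_le sgn_if)
  have size: "size (proots (P k)) = degree (P k)" for k
    using zeros[of k] size_proots_le[of "P k"] by (cases "k = 0") (simp_all add: deg)
  \<comment> \<open>Both leading coefficients are positive, which rules out the alternative with
    opposite signs.\<close>
  have il: "P n \<preceq>\<^sub>I P m"
    using interl[of n] unfolding signed_interlaces_def m_def lead by simp
  have "degree (P m) = Suc (degree (P n))" "sgn (lead_coeff (P n)) = sgn (lead_coeff (P m))"
    by (simp_all only: lead) (simp add: deg m_def)
  then obtain c \<rho> Q where "\<forall>i<degree (P m). 0 \<le> c i"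
    "\<forall>i<degree (P m). [:- \<rho> i, 1:] * Q i = P m"
    "P n = (\<Sum>i<degree (P m). smult (c i) (Q i))"
    by (rule interlaces_partial_fractions[OF il _ _ size size])
  note c = this(1)[unfolded deg, rule_format] and Q = this(2)[unfolded deg, rule_format] and Pn = this(3)[unfolded deg]
  have stab: "cpoly (P m) z \<noteq> 0" if "0 < Re z" for z
  proof
    assume 0: "cpoly (P m) z = 0"
    then have "z \<in> \<real>"
      using il by (simp add: interlaces_def real_rooted_def)
    then obtain x where x: "z = of_real x"
      by (rule Reals_cases)
    then show False
      using 0 that poly_pos_of_nonneg_coeffs[OF nz[of m] nonneg, of x] by (simp add: cpoly_of_real)
  qed
  have root: "poly (P m) (\<rho> i) = 0" if "i < m" for i
    unfolding Q[OF that, symmetric] by simp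
  have rho: "\<rho> i \<le> 0" if "i < m" for i
    using poly_pos_of_nonneg_coeffs[OF nz[of m] nonneg, of "\<rho> i"] root[OF that] by force
  \<comment> \<open>The zeros of the partial fractions are matched by value with the given list
    \<open>r m\<close>; equal zeros may share an index.\<close>
  have "\<exists>k\<in>{1..m}. r m k = \<rho> i" if "i < m" for i
  proof -
    have "\<rho> i \<in># proots (P m)"
      using root[OF that] nz[of m] by simp
    then show ?thesis
      unfolding zeros[OF m(1)] by auto
  qed
  then obtain k where k: "\<And>i. i < m \<Longrightarrow> k i \<in> {1..m}" "\<And>i. i < m \<Longrightarrow> r m (k i) = \<rho> i"
    by metis
  obtain \<sigma> :: real where \<sigma>: "\<sigma> = 1 \<or> \<sigma> = -1"
    "\<And>j. j \<in> {1..m} \<Longrightarrow> 0 \<le> \<sigma> * a m j 0 \<and> 0 \<le> \<sigma> * a m j 1 \<and> \<sigma> * a m j 3 \<le> 0"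
  proof -
    from sign_coeffs[OF m(1)]
    consider "\<And>j. j \<in> {1..m} \<Longrightarrow> 0 \<le> 1 * a m j 0 \<and> 0 \<le> 1 * a m j 1 \<and> 1 * a m j 3 \<le> 0"
      | "\<And>j. j \<in> {1..m} \<Longrightarrow> 0 \<le> (-1) * a m j 0 \<and> 0 \<le> (-1) * a m j 1 \<and> (-1) * a m j 3 \<le> 0"
      unfolding same_sign_def by fastforce
    then show thesis
      by cases (rule that[rotated], assumption+, simp)+
  qed
  \<comment> \<open>The weight \<open>c i\<close> and the common sign \<sigma> are absorbed here, so
    that \<open>b\<close> has the sign pattern required by
    \<open>hurwitz_stable_sum_nonneg\<close>.\<close>
  define b where "b i j = \<sigma> * c i * a m (k i) j" for i j
  define G where "G i = (\<Sum>j=0..3. smult (b i j) ([:- \<rho> i, 1:] ^ j))" for i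
  have G_eq: "G i = smult (\<sigma> * c i) (\<Sum>j=0..3. smult (a m (k i) j) ([:- \<rho> i, 1:] ^ j))" for i
    by (simp add: G_def b_def smult_sum_right mult.assoc)
  have turan: "turan_poly P n = smult (- \<sigma>) (h m * (\<Sum>i<m. (Q i)\<^sup>2 * G i))"
  proof -
    have "turan_poly P n = (P m)\<^sup>2 - P (m + 1) * P n"
      by (simp add: turan_poly_def m_def)
    also have "\<dots> = - (\<Sum>i<m. smult (c i) ((Q i)\<^sup>2 * ([:- \<rho> i, 1:] * (p m - p n) + q)))"
      by (rule turan_identity[OF rec[of n, folded m_def] rec[of m] _ Pn]) (use Q in simp)
    also have "(\<Sum>i<m. smult (c i) ((Q i)\<^sup>2 * ([:- \<rho> i, 1:] * (p m - p n) + q)))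
      = (\<Sum>i<m. smult \<sigma> (h m * ((Q i)\<^sup>2 * G i)))"
    proof (rule sum.cong)
      fix i assume "i \<in> {..<m}"
      then have i: "i < m"
        by simp
      have *: "[:- \<rho> i, 1:] * (p m - p n) + q
          = h m * (\<Sum>j=0..3. smult (a m (k i) j) ([:- \<rho> i, 1:] ^ j))"
        using decomp[OF m(1) k(1)[OF i]] unfolding k(2)[OF i] m(2) .
      \<comment> \<open>Since \<sigma> is 1 or -1, the copy of \<sigma> inside \<open>b\<close> is
        cancelled by the one pulled out in front of the sum.\<close>
      have "\<sigma> * (\<sigma> * c i) = c i"
        using \<sigma>(1) by auto
      then show "smult (c i) ((Q i)\<^sup>2 * ([:- \<rho> i, 1:] * (p m - p n) + q))
          = smult \<sigma> (h m * ((Q i)\<^sup>2 * G i))"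
        unfolding * G_eq by (simp only: mult_smult_right smult_smult mult.left_commute)
    qed simp
    finally show ?thesis
      by (simp add: sum_distrib_left smult_sum_right sum_negf)
  qed
  have "hurwitz_stable (map_poly complex_of_real (h m * (\<Sum>i<m. (Q i)\<^sup>2 * G i)))"
    unfolding G_def
  proof (rule hurwitz_stable_sum_nonneg[OF _ stab _ _ _ stable[OF m(1)]])
    fix i assume "i \<in> {..<m}"
    then have i: "i < m"
      by simp
    show "[:- \<rho> i, 1:] * Q i = P m" "\<rho> i \<le> 0"
      using Q[OF i] rho[OF i] .
    have "b i j = c i * (\<sigma> * a m (k i) j)" for j
      by (simp add: b_def)
    then show "0 \<le> b i 0 \<and> 0 \<le> b i 1 \<and> b i 3 \<le> 0"
      using c[OF i] \<sigma>(2)[OF k(1)[OF i]] by (simp only: mult_nonneg_nonneg mult_nonneg_nonpos)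
  next
    let ?S = "{poly (h m) x * (\<Sum>i=0..3. a m k i * (x - r m k) ^ i) | k x. k \<in> {1..m} \<and> x > 0}"
    have "\<exists>w\<in>?S. \<exists>t\<ge>0. v = \<sigma> * (t * w)"
      if "v \<in> {poly (h m) x * poly (G i) x | i x. i \<in> {..<m} \<and> 0 < x}" for v
    proof -
      from that obtain i x where v: "v = poly (h m) x * poly (G i) x" and i: "i < m" and x: "0 < x"
        by auto
      let ?w = "poly (h m) x * (\<Sum>j=0..3. a m (k i) j * (x - r m (k i)) ^ j)"
      have "v = \<sigma> * (c i * ?w)"
        unfolding v G_eq k(2)[OF i] by (simp add: poly_sum)
      moreover have "?w \<in> ?S"
        using k(1)[OF i] x by blast
      ultimately show ?thesis
        using c[OF i] by blast
    qed
    then show "same_sign {poly (h m) x * poly (\<Sum>j=0..3. smult (b i j) ([:- \<rho> i, 1:] ^ j)) x | i x.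
        i \<in> {..<m} \<and> 0 < x}"
      unfolding G_def by (rule same_sign_scaled[OF sign_values[OF m(1)]])
  qed simp_all
  then show "hurwitz_stable (map_poly complex_of_real (turan_poly P n))"
    using \<sigma>(1) unfolding turan by (auto simp: hurwitz_stable_of_real_minus)
qed

end
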